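(* Let $k\ge 2$, let $\Sigma=\{\sigma_0,\dots,\sigma_{k-1}\}$ be a finite alphabet with $\sigma_j$ having symbol code $j$, and let $\beta=k+1$. Define $\ulcorner\cdot\urcorner:\Sigma^*\to\mathbb{N}$ by $\ulcorner\varepsilon\urcorner=0$ for the empty string and, for a nonempty string $s=s_1\cdots s_m$ with symbol codes $c_1,\dots,c_m$, \[\ulcorner s\urcorner=\sum_{i=0}^{m-1}F_{2+i\beta+c_{i+1}}.\] Then $\ulcorner\cdot\urcorner$ is injective on $\Sigma^*$: if $s\neq t$ then $\ulcorner s\urcorner\neq\ulcorner t\urcorner$.
   Context: $F_n$ denotes the Fibonacci sequence with $F_0=0$, $F_1=1$, $F_{n+2}=F_{n+1}+F_n$. *)

theory Defs
  imports "HOL-Number_Theory.Fib"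
begin

text \<open>
  \<open>code\<close> assigns symbol codes and \<open>\<beta>\<close> is the block width. List positions are 0-based, so
  \<open>s ! i\<close> is the symbol $s_{i+1}$; the empty string gives the empty sum 0.
\<close>

definition fib_encode :: "nat \<Rightarrow> ('a \<Rightarrow> nat) \<Rightarrow> 'a list \<Rightarrow> nat" where
  "fib_encode \<beta> code s = (\<Sum>i<length s. fib (2 + i * \<beta> + code (s ! i)))"

end

theory Submission
  imports Defs
begin

text \<open>
  Codes are at most \<open>\<beta> - 2\<close>, so consecutive Fibonacci indices in the sum differ by at least 2, as in
  a Zeckendorf representation. Hence the value of a nonempty string lies in the interval
  $[F_n, F_{n+1})$, where $n$ is its top index. This determines $n$, which determines the
  length and the last symbol by division by \<open>\<beta>\<close>; removing the last symbol, one descends to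
  shorter strings.
\<close>

lemma fib_encode_Nil: "fib_encode \<beta> code [] = 0"
  by (simp add: fib_encode_def)

lemma fib_encode_snoc:
  "fib_encode \<beta> code (s @ [x]) = fib_encode \<beta> code s + fib (2 + length s * \<beta> + code x)"
  by (simp add: fib_encode_def nth_append)

text \<open>Induction from the right: if the last index is \<open>n\<close>, the prefix contributes
  less than \<open>fib (n - 1)\<close>, so the sum stays below \<open>fib (n + 1)\<close>.\<close>

lemma fib_encode_less:
  assumes "\<forall>x\<in>set s. code x + 2 \<le> \<beta>"
  shows "fib_encode \<beta> code s < fib (length s * \<beta> + 1)"
  using assms
proof (induction s rule: rev_induct)
  case Nil
  then show ?case by (simp add: fib_encode_Nil)
next
  case (snoc x s)
  let ?n = "2 + length s * \<beta> + code x"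
  have "fib_encode \<beta> code s < fib (length s * \<beta> + 1)"
    using snoc by simp
  \<comment> \<open>The subtraction does not truncate: \<open>?n - 1\<close> is
    \<open>length s * \<beta> + code x + 1\<close>.\<close>
  also have "\<dots> \<le> fib (?n - 1)"
    by (intro fib_mono) simp
  finally have "fib_encode \<beta> code (s @ [x]) < fib (?n - 1) + fib ?n"
    by (simp add: fib_encode_snoc)
  also have "\<dots> = fib (?n + 1)"
    by simp
  \<comment> \<open>Comparing indices, this amounts exactly to
    \<open>code x + 2 \<le> \<beta>\<close>.\<close>
  also have "\<dots> \<le> fib (length (s @ [x]) * \<beta> + 1)"
    using snoc.prems by (intro fib_mono) simp
  finally show ?case .
qed

text \<open>Sharpens the previous bound from the block end to the actual top index, again by the
  Fibonacci recurrence.\<close>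

lemma fib_encode_snoc_less:
  assumes "\<forall>x\<in>set s. code x + 2 \<le> \<beta>"
  shows "fib_encode \<beta> code (s @ [x]) < fib (2 + length s * \<beta> + code x + 1)"
proof -
  have "fib_encode \<beta> code s < fib (length s * \<beta> + 1)"
    using assms by (rule fib_encode_less)
  also have "\<dots> \<le> fib (length s * \<beta> + code x + 1)"
    by (intro fib_mono) simp
  finally show ?thesis
    by (simp add: fib_encode_snoc)
qed

lemma fib_encode_eq_0_iff: "fib_encode \<beta> code s = 0 \<longleftrightarrow> s = []"
  by (cases s rule: rev_cases) (simp_all add: fib_encode_Nil fib_encode_snoc fib_neq_0_nat)

text \<open>A larger top index on the left would put its last term alone at or above the strict
  upper bound for the right. Applied in both directions, this gives equal top indices.\<close>

lemma fib_encode_snoc_index_le: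
  assumes "\<forall>x\<in>set t. code x + 2 \<le> \<beta>"
    and "fib_encode \<beta> code (s @ [x]) = fib_encode \<beta> code (t @ [y])"
  shows "length s * \<beta> + code x \<le> length t * \<beta> + code y"
proof (rule ccontr)
  assume "\<not> ?thesis"
  then have "fib (2 + length t * \<beta> + code y + 1) \<le> fib (2 + length s * \<beta> + code x)"
    by (intro fib_mono) simp
  also have "\<dots> \<le> fib_encode \<beta> code (s @ [x])"
    by (simp add: fib_encode_snoc)
  finally show False
    using fib_encode_snoc_less[OF assms(1), of y] assms(2) by simp
qed

lemma fib_encode_inject:
  assumes "inj_on code A" and "\<And>x. x \<in> A \<Longrightarrow> code x + 2 \<le> \<beta>"
    and "s \<in> lists A" and "t \<in> lists A"
    and "fib_encode \<beta> code s = fib_encode \<beta> code t"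
  shows "s = t"
  using assms(3-)
proof (induction s arbitrary: t rule: rev_induct)
  case Nil
  then show ?case
    using fib_encode_eq_0_iff[of \<beta> code t] by (simp add: fib_encode_Nil)
next
  case (snoc x s)
  have "t \<noteq> []"
    using snoc.prems(3) fib_encode_eq_0_iff[of \<beta> code "s @ [x]"] by (auto simp: fib_encode_Nil)
  then obtain u y where t: "t = u @ [y]"
    by (cases t rule: rev_cases) auto
  have mem: "x \<in> A" "y \<in> A" "s \<in> lists A" "u \<in> lists A"
    using snoc.prems t by auto
  then have codes: "\<forall>x\<in>set s. code x + 2 \<le> \<beta>" "\<forall>x\<in>set u. code x + 2 \<le> \<beta>"
    using assms(2) by auto
  have eq: "fib_encode \<beta> code (s @ [x]) = fib_encode \<beta> code (u @ [y])"
    using snoc.prems t by simp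
  have index: "length s * \<beta> + code x = length u * \<beta> + code y"
    using fib_encode_snoc_index_le[OF codes(2) eq] fib_encode_snoc_index_le[OF codes(1) eq[symmetric]]
    by simp
  have "code x < \<beta>" "code y < \<beta>"
    using assms(2)[OF mem(1)] assms(2)[OF mem(2)] by simp_all
  \<comment> \<open>Both codes are below \<open>\<beta>\<close>, so they are the remainders of the
    common index.\<close>
  then have "code x = code y"
    using arg_cong[OF index, of "\<lambda>n. n mod \<beta>"] by simp
  then have "x = y"
    using assms(1) mem by (simp add: inj_on_eq_iff)
  \<comment> \<open>Equal indices make the two last terms equal, so they cancel.\<close>
  moreover have "fib_encode \<beta> code s = fib_encode \<beta> code u"
    using eq index by (simp add: fib_encode_snoc)
  then have "s = u"
    using snoc.IH mem by blast
  ultimately show ?case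
    using t by simp
qed

theorem theorem4p2:
  fixes k \<beta> :: nat
    and \<sigma> :: "nat \<Rightarrow> 'a"
    and \<Sigma> :: "'a set"
    and code :: "'a \<Rightarrow> nat"
  assumes "k \<ge> 2"
    and "\<Sigma> = \<sigma> ` {..<k}"
    and "\<And>j. j < k \<Longrightarrow> code (\<sigma> j) = j"
    and "\<beta> = k + 1"
  shows "inj_on (fib_encode \<beta> code) (lists \<Sigma>)"
proof (rule inj_onI)
  have "inj_on code \<Sigma>"
    using assms(2,3) by (auto intro!: inj_onI)
  \<comment> \<open>The largest code is \<open>k - 1\<close>, for which
    \<open>\<beta> = k + 1\<close> gives equality.\<close>
  moreover have "code x + 2 \<le> \<beta>" if "x \<in> \<Sigma>" for x
    using that assms(2-4) by auto
  ultimately show "s = t" if "s \<in> lists \<Sigma>" "t \<in> lists \<Sigma>"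
    "fib_encode \<beta> code s = fib_encode \<beta> code t" for s t
    using that by (rule fib_encode_inject)
qed

end
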